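(* Let $\phi\in\mathbb{R}$ be a constant. Suppose that at the social optimum $q^*=(q_i^* )_{i\in\mathcal N}$, i.e. an optimal solution of $$\min_{q_i\ge 0,\ i\in\mathcal N}\ \sum_{i\in\mathcal N} C_i(q_i)\quad\text{s.t.}\quad \sum_{i\in\mathcal N} q_i=d,$$ there are at least two firms $i\in\mathcal N$ with $q_i^*>0$. Then a Nash equilibrium among strategic firms in the presence of the efficiency recovery mechanism exists. Moreover, it is efficient: for a Nash equilibrium $(B,p)$ in the presence of the efficiency recovery mechanism, the supply dispatch $q_i=b_ip$, $i\in\mathcal N$, is an optimal solution of the social cost minimization problem $$\min_{q_i\ge 0,\ i\in\mathcal N}\ \sum_{i\in\mathcal N} C_i(q_i)\quad\text{s.t.}\quad \sum_{i\in\mathcal N} q_i=d.$$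
   Context: Market. $\mathcal N=\{1,\dots,|\mathcal N|\}$ is a finite set of firms and $d>0$ is a given inelastic demand. Each firm $i$ has a production cost function $C_i:\mathbb R\to\mathbb R$ that is continuously differentiable, convex and strictly increasing, with $C_i(0)=0$. Each firm $i$ chooses a bid $b_i\ge 0$; at price $p$ it supplies $q_i=b_ip$. Write $B=(b_i)_{i\in\mathcal N}$, $B_{-i}=(b_j)_{j\ne i}$ and $\sum_{-i}b_j=\sum_{j\in\mathcal N\setminus\{i\}}b_j$. Supply matches demand, $\sum_i q_i=d$, through the market clearing price $p(B)=d/\sum_{i}b_i$. If all firms bid $0$, the bids are rejected by the market (the all-zero bid profile is not admissible). Efficiency recovery mechanism with constant $\phi$. Each firm $i$ receives the extra term $$\Delta\pi_i=\frac{q_i^2}{2\sum_{-i}b_j}-\phi\,\frac{d^2}{2\sum_{-i}b_j}\qquad\text{if }\sum_{-i}b_j>0,$$ and if $\sum_{-i}b_j=0$, $\Delta\pi_i$ is set to a sufficiently large constant (not depending on $b_i$). Strategic bidding. Given $B_{-i}$, firm $i$ solves $$\max_{b_i\ge 0}\ \pi_i^\dagger(b_i;B_{-i})=p\,q_i-C_i(q_i)+\Delta\pi_i=p^2b_i-C_i(pb_i)+\Delta\pi_i,\qquad p=\frac{d}{\sum_j b_j}$$ (over admissible bids, i.e. with $b_i>0$ when $\sum_{-i}b_j=0$). Nash equilibrium in the presence of the efficiency recovery mechanism: a tuple $(B,p)$ such that (1) for every $i\in\mathcal N$, $b_i$ is optimal for firm $i$'s strategic bidding problem given $B_{-i}$;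 and (2) supply matches demand, $\sum_i b_ip=d$. *)

theory Defs
  imports "HOL-Analysis.Analysis"
begin

definition cost_function :: "(real \<Rightarrow> real) \<Rightarrow> bool" where
  "cost_function c \<longleftrightarrow>
     c C1_differentiable_on UNIV \<and> convex_on UNIV c \<and> strict_mono c \<and> c 0 = 0"

definition feasible_dispatch :: "'i set \<Rightarrow> real \<Rightarrow> ('i \<Rightarrow> real) \<Rightarrow> bool" where
  "feasible_dispatch N d q \<longleftrightarrow> (\<forall>i\<in>N. 0 \<le> q i) \<and> (\<Sum>i\<in>N. q i) = d"

definition social_optimum ::
    "'i set \<Rightarrow> ('i \<Rightarrow> real \<Rightarrow> real) \<Rightarrow> real \<Rightarrow> ('i \<Rightarrow> real) \<Rightarrow> bool" where
  "social_optimum N C d q \<longleftrightarrow>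
     is_arg_min (\<lambda>r. \<Sum>i\<in>N. C i (r i)) (feasible_dispatch N d) q"

definition others_bid :: "'i set \<Rightarrow> ('i \<Rightarrow> real) \<Rightarrow> 'i \<Rightarrow> real" where
  "others_bid N B i = (\<Sum>j\<in>N - {i}. B j)"

definition clearing_price :: "'i set \<Rightarrow> real \<Rightarrow> ('i \<Rightarrow> real) \<Rightarrow> real" where
  "clearing_price N d B = d / (\<Sum>j\<in>N. B j)"

definition supplied_quantity :: "'i set \<Rightarrow> real \<Rightarrow> ('i \<Rightarrow> real) \<Rightarrow> 'i \<Rightarrow> real" where
  "supplied_quantity N d B i = B i * clearing_price N d B"

text \<open>The number \<open>K i\<close> is the constant credited to firm \<open>i\<close> when nobody else bids. No lower
  bound on it is imposed, so a sufficiently large constant is one possible choice.\<close>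

definition recovery_term ::
    "'i set \<Rightarrow> real \<Rightarrow> real \<Rightarrow> ('i \<Rightarrow> real) \<Rightarrow> ('i \<Rightarrow> real) \<Rightarrow> 'i \<Rightarrow> real" where
  "recovery_term N d \<phi> K B i =
     (if others_bid N B i > 0
      then (supplied_quantity N d B i)\<^sup>2 / (2 * others_bid N B i) - \<phi> * (d\<^sup>2 / (2 * others_bid N B i))
      else K i)"

definition payoff ::
    "'i set \<Rightarrow> ('i \<Rightarrow> real \<Rightarrow> real) \<Rightarrow> real \<Rightarrow> real \<Rightarrow> ('i \<Rightarrow> real) \<Rightarrow> ('i \<Rightarrow> real) \<Rightarrow> 'i \<Rightarrow> real" where
  "payoff N C d \<phi> K B i =
     clearing_price N d B * supplied_quantity N d B i - C i (supplied_quantity N d B i) + recovery_term N d \<phi> K B i"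

text \<open>The market rejects the all-zero profile, so a firm facing only zero bids must bid
  a positive amount.\<close>

definition admissible_bid :: "'i set \<Rightarrow> ('i \<Rightarrow> real) \<Rightarrow> 'i \<Rightarrow> real \<Rightarrow> bool" where
  "admissible_bid N B i x \<longleftrightarrow> 0 \<le> x \<and> (others_bid N B i = 0 \<longrightarrow> 0 < x)"

text \<open>Below, only the values of \<open>B\<close> at firms other than \<open>i\<close> matter in the two arguments of
  \<open>is_arg_max\<close>: the bid of firm \<open>i\<close> itself is overwritten by \<open>x\<close>.\<close>

definition optimal_bid ::
    "'i set \<Rightarrow> ('i \<Rightarrow> real \<Rightarrow> real) \<Rightarrow> real \<Rightarrow> real \<Rightarrow> ('i \<Rightarrow> real) \<Rightarrow> ('i \<Rightarrow> real) \<Rightarrow> 'i \<Rightarrow> real \<Rightarrow> bool" where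
  "optimal_bid N C d \<phi> K B i b \<longleftrightarrow>
     is_arg_max (\<lambda>x. payoff N C d \<phi> K (B(i := x)) i) (admissible_bid N B i) b"

definition nash_equilibrium ::
    "'i set \<Rightarrow> ('i \<Rightarrow> real \<Rightarrow> real) \<Rightarrow> real \<Rightarrow> real \<Rightarrow> ('i \<Rightarrow> real) \<Rightarrow> ('i \<Rightarrow> real) \<Rightarrow> real \<Rightarrow> bool" where
  "nash_equilibrium N C d \<phi> K B p \<longleftrightarrow>
     (\<forall>i\<in>N. optimal_bid N C d \<phi> K B i (B i)) \<and> (\<Sum>i\<in>N. B i * p) = d"

end

theory Submission
  imports Defs
begin

text \<open>
  Write \<open>s > 0\<close> for the sum of the bids of the competitors of firm \<open>i\<close>. As its bid \<open>b\<close> runs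
  through \<open>[0, \<infinity>)\<close>, its sales \<open>q = b d / (b + s)\<close> run through \<open>[0, d)\<close>, and the clearing price
  \<open>d / (b + s)\<close> equals \<open>(d - q) / s\<close>. Revenue alone, \<open>q (d - q) / s\<close>, has the derivative
  \<open>(d - 2 q) / s\<close>, which for \<open>q > 0\<close> lies below the price: this is market power. The payment
  \<open>q\<^sup>2 / (2 s)\<close> turns revenue into \<open>(d q - q\<^sup>2 / 2) / s\<close>, whose derivative is exactly the price, and
  the other part of the recovery term does not depend on \<open>b\<close>. So a strategic firm stops where price
  meets marginal cost, just as a price taker does (\<open>optimal_bid_iff_price_supports\<close>).

  Nash equilibria are therefore the competitive equilibria in which every firm has an active
  competitor. For efficiency, adding up the price-taking inequalities of the firms shows that the
  dispatch is socially optimal (\<open>price_supports_imp_social_optimum\<close>), and every firm does have an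
  active competitor, because a sole bidder can always raise the price by bidding less
  (\<open>no_optimal_bid_alone\<close>). For existence, let \<open>p\<close> be the marginal cost of an active firm at the
  social optimum \<open>q\<close>. Active firms share this marginal cost and idle firms have at least this
  marginal cost, so \<open>p\<close> supports \<open>q\<close> (\<open>social_optimum_imp_price_supports\<close>). The bids \<open>q i / p\<close>
  reproduce \<open>q\<close> at the price \<open>p\<close>, and since two firms are active, every firm faces a positive
  competing bid.
\<close>

section \<open>Strategic profit and price taking\<close>

text \<open>The price-taking condition: \<open>q\<close> maximizes \<open>p y - c y\<close> over \<open>0 \<le> y \<le> d\<close>. It replaces the
  comparison of \<open>p\<close> with the marginal cost, and so treats interior and boundary quantities alike.\<close>

definition price_supports :: "(real \<Rightarrow> real) \<Rightarrow> real \<Rightarrow> real \<Rightarrow> real \<Rightarrow> bool" where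
  "price_supports c d p q \<longleftrightarrow> (\<forall>y\<in>{0..d}. p * (y - q) \<le> c y - c q)"

text \<open>The payoff of a firm as a function of its sales \<open>q\<close> against competing bids of total \<open>s\<close>,
  up to the part of the recovery term that does not depend on \<open>q\<close>.\<close>

definition quantity_profit :: "(real \<Rightarrow> real) \<Rightarrow> real \<Rightarrow> real \<Rightarrow> real \<Rightarrow> real" where
  "quantity_profit c d s q = (d * q - q\<^sup>2 / 2) / s - c q"

text \<open>The expansion of the profit around \<open>q\<close> has the price \<open>(d - q) / s\<close> induced by \<open>q\<close> itself as the
  coefficient of its linear revenue term. The quadratic term has a favourable sign when price taking
  is to imply optimality, and is of second order for the converse.\<close>

lemma quantity_profit_diff:
  assumes "s > 0"
  shows "quantity_profit c d s y - quantity_profit c d s q =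
    (d - q) / s * (y - q) - (c y - c q) - (y - q)\<^sup>2 / (2 * s)"
  using assms by (simp add: quantity_profit_def field_simps power2_eq_square)

text \<open>From price taking to maximal profit, drop the quadratic term of the expansion. Conversely,
  apply the expansion to the points \<open>q + t (y - q)\<close>, bound the cost there by convexity, divide by
  \<open>t\<close>, and let \<open>t\<close> tend to \<open>0\<close>. Only values \<open>t < 1\<close> occur, which is why \<open>y = d\<close> is covered on the
  right although sales \<open>d\<close> are out of reach on the left.\<close>

lemma profit_maximal_iff_price_supports:
  assumes cvx: "convex_on UNIV c" and s: "s > 0" and q: "0 \<le> q" "q < d"
  shows "(\<forall>y\<in>{0..<d}. quantity_profit c d s y \<le> quantity_profit c d s q) \<longleftrightarrow>
    price_supports c d ((d - q) / s) q"
proof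
  assume max: "\<forall>y\<in>{0..<d}. quantity_profit c d s y \<le> quantity_profit c d s q"
  define p where "p = (d - q) / s"
  have "p * (y - q) \<le> c y - c q" if y: "y \<in> {0..d}" for y
  proof -
    define h where "h = y - q"
    have bound: "p * h - t * (h\<^sup>2 / (2 * s)) \<le> c y - c q" if t: "0 < t" "t < 1" for t
    proof -
      define z where "z = (1 - t) * q + t * y"
      have zq: "z - q = t * h"
        by (simp add: z_def h_def algebra_simps)
      have "(1 - t) * q + t * y < (1 - t) * d + t * d"
        using t q y by (intro add_less_le_mono mult_strict_left_mono mult_left_mono) auto
      then have "z < d"
        by (simp add: z_def algebra_simps)
      moreover have "0 \<le> z"
        unfolding z_def using t q y by (intro add_nonneg_nonneg mult_nonneg_nonneg) auto
      ultimately have "z \<in> {0..<d}"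
        by simp
      then have "quantity_profit c d s z - quantity_profit c d s q \<le> 0"
        using max by simp
      then have "p * (t * h) - (c z - c q) - (t * h)\<^sup>2 / (2 * s) \<le> 0"
        unfolding quantity_profit_diff[OF s, of c d z q] zq p_def .
      moreover have "c z \<le> (1 - t) * c q + t * c y"
        using convex_onD[OF cvx, of t q y] t by (simp add: z_def)
      ultimately have "t * (p * h - t * (h\<^sup>2 / (2 * s))) \<le> t * (c y - c q)"
        by (simp add: algebra_simps power2_eq_square)
      then show ?thesis
        using t by simp
    qed
    have "((\<lambda>t. p * h - t * (h\<^sup>2 / (2 * s))) \<longlongrightarrow> p * h - 0 * (h\<^sup>2 / (2 * s))) (at_right 0)"
      by (intro tendsto_intros)
    moreover have "\<forall>\<^sub>F t in at_right 0. p * h - t * (h\<^sup>2 / (2 * s)) \<le> c y - c q"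
      using bound eventually_at_right_less[of "0::real"] eventually_at_right_real[of 0 "1::real"]
      by (auto elim: eventually_mono)
    ultimately have "p * h - 0 * (h\<^sup>2 / (2 * s)) \<le> c y - c q"
      by (rule tendsto_upperbound) simp
    then show ?thesis
      by (simp add: h_def)
  qed
  then show "price_supports c d ((d - q) / s) q"
    by (simp add: price_supports_def p_def)
next
  assume "price_supports c d ((d - q) / s) q"
  then have "(d - q) / s * (y - q) \<le> c y - c q" if "y \<in> {0..<d}" for y
    using that unfolding price_supports_def by simp
  moreover have "0 \<le> (y - q)\<^sup>2 / (2 * s)" for y
    using s by simp
  ultimately have "quantity_profit c d s y - quantity_profit c d s q \<le> 0" if "y \<in> {0..<d}" for y
    unfolding quantity_profit_diff[OF s, of c d y q] using that
    by (simp only: diff_le_0_iff_le) (meson diff_le_0_iff_le order_trans)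
  then show "\<forall>y\<in>{0..<d}. quantity_profit c d s y \<le> quantity_profit c d s q"
    by simp
qed

section \<open>Optimal bids\<close>

lemma sum_eq_bid_plus_others:
  assumes "finite N" "i \<in> N"
  shows "(\<Sum>j\<in>N. B j) = B i + others_bid N B i"
  using assms by (simp add: others_bid_def sum.remove)

lemma others_bid_update [simp]: "others_bid N (B(i := x)) i = others_bid N B i"
  by (simp add: others_bid_def)

lemma clearing_price_update:
  assumes "finite N" "i \<in> N"
  shows "clearing_price N d (B(i := x)) = d / (x + others_bid N B i)"
  using sum_eq_bid_plus_others[OF assms, of "B(i := x)"] by (simp only: clearing_price_def) simp

lemma price_eq_residual_demand:
  fixes s x d :: real
  assumes "s > 0" "0 \<le> x"
  shows "d / (x + s) = (d - x * d / (x + s)) / s"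
proof -
  have "d - x * d / (x + s) = s * (d / (x + s))"
    using assms by (simp add: field_simps)
  then show ?thesis
    using assms by simp
qed

lemma payoff_update_eq_quantity_profit:
  assumes "finite N" "i \<in> N" and s: "others_bid N B i > 0" and x: "0 \<le> x"
  shows "payoff N C d \<phi> K (B(i := x)) i =
    quantity_profit (C i) d (others_bid N B i) (x * d / (x + others_bid N B i))
      - \<phi> * (d\<^sup>2 / (2 * others_bid N B i))"
proof -
  define s where "s = others_bid N B i"
  define q where "q = x * d / (x + s)"
  have "d / (x + s) = (d - q) / s"
    unfolding q_def s_def using s x by (rule price_eq_residual_demand)
  moreover have "clearing_price N d (B(i := x)) = d / (x + s)"
    using assms by (simp add: clearing_price_update s_def)
  moreover have "supplied_quantity N d (B(i := x)) i = q"
    using calculation(2) by (simp add: supplied_quantity_def q_def)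
  ultimately have "payoff N C d \<phi> K (B(i := x)) i =
      (d - q) / s * q - C i q + (q\<^sup>2 / (2 * s) - \<phi> * (d\<^sup>2 / (2 * s)))"
    using s by (simp add: payoff_def recovery_term_def flip: s_def)
  also have "\<dots> = quantity_profit (C i) d s q - \<phi> * (d\<^sup>2 / (2 * s))"
    using s by (simp add: quantity_profit_def s_def field_simps power2_eq_square)
  finally show ?thesis
    by (simp add: s_def q_def)
qed

text \<open>Choosing a bid amounts to choosing sales below the whole demand; sales \<open>y\<close> are obtained
  with the bid \<open>y s / (d - y)\<close>.\<close>

lemma range_of_quantity:
  fixes s d :: real
  assumes "s > 0" "d > 0"
  shows "(\<lambda>x. x * d / (x + s)) ` {0..} = {0..<d}"
proof (intro equalityI subsetI)
  fix y assume y: "y \<in> {0..<d}"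
  have "y = (y * s / (d - y)) * d / (y * s / (d - y) + s)"
  proof -
    have "y * s / (d - y) + s = s * d / (d - y)"
      using y by (simp add: field_simps)
    then show ?thesis
      using y assms by simp
  qed
  moreover have "y * s / (d - y) \<in> {0..}"
    using y assms by simp
  ultimately show "y \<in> (\<lambda>x. x * d / (x + s)) ` {0..}"
    by blast
next
  fix y assume "y \<in> (\<lambda>x. x * d / (x + s)) ` {0..}"
  then obtain x where "x \<ge> 0" "y = x * d / (x + s)"
    by auto
  then show "y \<in> {0..<d}"
    using assms by (simp add: pos_divide_less_eq algebra_simps)
qed

text \<open>The effect of the mechanism: a best response against active competitors is exactly what a
  price taker would supply at the clearing price that results from it.\<close>

lemma optimal_bid_iff_price_supports:
  assumes "finite N" "i \<in> N" "d > 0" and cvx: "convex_on UNIV (C i)"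
    and s: "others_bid N B i > 0" and b: "0 \<le> b"
  shows "optimal_bid N C d \<phi> K B i b \<longleftrightarrow>
    price_supports (C i) d (d / (b + others_bid N B i)) (b * d / (b + others_bid N B i))"
proof -
  define s where "s = others_bid N B i"
  define q where "q = b * d / (b + s)"
  have spos: "s > 0" using s by (simp add: s_def)
  have q: "0 \<le> q" "q < d"
    using range_of_quantity[OF spos \<open>d > 0\<close>] b by (auto simp: q_def)
  have p: "d / (b + s) = (d - q) / s"
    unfolding q_def using spos b by (rule price_eq_residual_demand)
  have "optimal_bid N C d \<phi> K B i b \<longleftrightarrow>
    (\<forall>x\<in>{0..}. quantity_profit (C i) d s (x * d / (x + s)) \<le> quantity_profit (C i) d s q)"
    using payoff_update_eq_quantity_profit[OF assms(1,2) s] b s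
    by (auto simp: optimal_bid_def is_arg_max_linorder admissible_bid_def q_def s_def)
  also have "\<dots> \<longleftrightarrow> (\<forall>y\<in>{0..<d}. quantity_profit (C i) d s y \<le> quantity_profit (C i) d s q)"
    unfolding range_of_quantity[OF spos \<open>d > 0\<close>, symmetric] by blast
  also have "\<dots> \<longleftrightarrow> price_supports (C i) d ((d - q) / s) q"
    by (rule profit_maximal_iff_price_supports[OF cvx spos q])
  finally show ?thesis
    using p by (simp add: q_def s_def)
qed

text \<open>A sole bidder sells \<open>d\<close> at the price \<open>d / b\<close>, and so halving its bid doubles its revenue while
  cost and recovery term stay the same.\<close>

lemma no_optimal_bid_alone:
  assumes "finite N" "i \<in> N" "d > 0" and s: "others_bid N B i = 0"
  shows "\<not> optimal_bid N C d \<phi> K B i b"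
proof
  assume opt: "optimal_bid N C d \<phi> K B i b"
  then have b: "b > 0"
    using s by (simp add: optimal_bid_def is_arg_max_def admissible_bid_def)
  have pay: "payoff N C d \<phi> K (B(i := x)) i = d / x * d - C i d + K i" if "x > 0" for x
    using assms that
    by (simp add: payoff_def recovery_term_def supplied_quantity_def clearing_price_update)
  have "payoff N C d \<phi> K (B(i := b / 2)) i \<le> payoff N C d \<phi> K (B(i := b)) i"
    using opt b s by (auto simp: optimal_bid_def is_arg_max_linorder admissible_bid_def)
  moreover have "d / b * d < d / (b / 2) * d"
    using b \<open>d > 0\<close> by (simp add: field_simps)
  ultimately show False
    using pay[of b] pay[of "b / 2"] b by simp
qed

section \<open>Supporting prices and the social optimum\<close>

text \<open>The first welfare theorem for this market: summed over the firms, the price terms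
  \<open>p (r i - q i)\<close> cancel because both dispatches meet the same demand.\<close>

lemma price_supports_imp_social_optimum:
  assumes "finite N" and feas: "feasible_dispatch N d q"
    and sup: "\<And>i. i \<in> N \<Longrightarrow> price_supports (C i) d p (q i)"
  shows "social_optimum N C d q"
  unfolding social_optimum_def is_arg_min_linorder
proof (intro conjI allI impI)
  fix r assume r: "feasible_dispatch N d r"
  have "r i \<in> {0..d}" if "i \<in> N" for i
    using r that member_le_sum[of i N r] \<open>finite N\<close> by (auto simp: feasible_dispatch_def)
  then have "(\<Sum>i\<in>N. p * (r i - q i)) \<le> (\<Sum>i\<in>N. C i (r i) - C i (q i))"
    using sup by (intro sum_mono) (simp add: price_supports_def)
  moreover have "(\<Sum>i\<in>N. p * (r i - q i)) = 0"
    using r feas by (simp add: feasible_dispatch_def sum_subtractf flip: sum_distrib_left)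
  ultimately show "(\<Sum>i\<in>N. C i (q i)) \<le> (\<Sum>i\<in>N. C i (r i))"
    by (simp add: sum_subtractf)
qed (rule feas)

text \<open>Otherwise it would pay to move a small amount \<open>e\<close> of production from \<open>i\<close> to \<open>j\<close>.\<close>

lemma marginal_cost_le_of_social_optimum:
  assumes "finite N" and opt: "social_optimum N C d q"
    and ij: "i \<in> N" "j \<in> N" and qi: "q i > 0"
    and Di: "(C i has_real_derivative Di) (at (q i))"
    and Dj: "(C j has_real_derivative Dj) (at (q j))"
  shows "Di \<le> Dj"
proof (rule ccontr)
  assume less: "\<not> Di \<le> Dj"
  have "i \<noteq> j"
    using less DERIV_unique[OF Di] Dj by auto
  define g where "g e = C i (q i - e) + C j (q j + e)" for e
  have "((\<lambda>e. C i (q i - e)) has_real_derivative Di * (0 - 1)) (at 0)"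
    by (rule DERIV_chain2[where f = "C i"]) (use Di in \<open>auto intro!: derivative_eq_intros\<close>)
  moreover have "((\<lambda>e. C j (q j + e)) has_real_derivative Dj * (0 + 1)) (at 0)"
    by (rule DERIV_chain2[where f = "C j"]) (use Dj in \<open>auto intro!: derivative_eq_intros\<close>)
  ultimately have "(g has_real_derivative Di * (0 - 1) + Dj * (0 + 1)) (at 0)"
    unfolding g_def by (rule DERIV_add)
  then have "(g has_real_derivative Dj - Di) (at 0)"
    by simp
  then obtain \<delta> where \<delta>: "\<delta> > 0" "\<And>e. e > 0 \<Longrightarrow> e < \<delta> \<Longrightarrow> g e < g 0"
    using DERIV_neg_dec_right[of g "Dj - Di" 0] less by auto
  define e where "e = min (\<delta> / 2) (q i)"
  have e: "e > 0" "e < \<delta>" "e \<le> q i"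
    using \<delta>(1) qi by (auto simp: e_def min_def)
  define r where "r = q(i := q i - e, j := q j + e)"
  have move: "(\<Sum>k\<in>N. f k (r k)) - (\<Sum>k\<in>N. f k (q k)) =
      (f i (q i - e) + f j (q j + e)) - (f i (q i) + f j (q j))" for f :: "'a \<Rightarrow> real \<Rightarrow> real"
  proof -
    have split: "sum h N = h i + (h j + sum h (N - {i} - {j}))" for h :: "'a \<Rightarrow> real"
      using sum.remove[of N i h] sum.remove[of "N - {i}" j h] \<open>finite N\<close> ij \<open>i \<noteq> j\<close> by simp
    have "(\<Sum>k\<in>N - {i} - {j}. f k (r k)) = (\<Sum>k\<in>N - {i} - {j}. f k (q k))"
      by (intro sum.cong) (auto simp: r_def)
    then show ?thesis
      using split[of "\<lambda>k. f k (r k)"] split[of "\<lambda>k. f k (q k)"] \<open>i \<noteq> j\<close> by (simp add: r_def)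
  qed
  have feas: "feasible_dispatch N d q"
    using opt by (simp add: social_optimum_def is_arg_min_def)
  have "sum r N = sum q N"
    using move[of "\<lambda>_ x. x"] by simp
  moreover have "\<forall>k\<in>N. 0 \<le> r k"
    using feas e ij by (simp add: r_def feasible_dispatch_def)
  ultimately have "feasible_dispatch N d r"
    using feas by (simp add: feasible_dispatch_def)
  then have "(\<Sum>k\<in>N. C k (q k)) \<le> (\<Sum>k\<in>N. C k (r k))"
    using opt by (simp add: social_optimum_def is_arg_min_linorder)
  then have "g 0 \<le> g e"
    using move[of C] by (simp add: g_def)
  then show False
    using \<delta>(2) e by fastforce
qed

text \<open>The second welfare theorem. The supporting price is the marginal cost of the active firm \<open>m\<close>; it
  is positive because the cost of \<open>m\<close> increases strictly from \<open>0\<close> to \<open>q m\<close> and, by convexity, at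
  most at the final slope.\<close>

lemma social_optimum_imp_price_supports:
  assumes "finite N" and cost: "\<And>i. i \<in> N \<Longrightarrow> cost_function (C i)"
    and opt: "social_optimum N C d q" and m: "m \<in> N" "q m > 0"
  obtains p where "p > 0" "\<And>i. i \<in> N \<Longrightarrow> price_supports (C i) d p (q i)"
proof -
  have "\<exists>D. (C i has_real_derivative D) (at x)" if "i \<in> N" for i x
    using cost[OF that]
    by (auto simp: cost_function_def C1_differentiable_on_def has_real_derivative_iff_has_vector_derivative)
  then obtain D where D: "\<And>i x. i \<in> N \<Longrightarrow> (C i has_real_derivative D i x) (at x)"
    by metis
  have tangent: "D i x * (y - x) \<le> C i y - C i x" if "i \<in> N" for i x y
    using convex_on_imp_above_tangent[of UNIV "C i" x y "D i x"] D[OF that, of x] cost[OF that]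
    by (simp add: cost_function_def)
  define p where "p = D m (q m)"
  have "C m 0 < C m (q m)"
    using cost[OF m(1)] m(2) unfolding cost_function_def by (blast intro: strict_monoD)
  then have "p * q m > 0"
    using tangent[OF m(1), of "q m" 0] unfolding p_def by simp
  then have "p > 0"
    using m(2) by (simp add: zero_less_mult_iff)
  moreover have "price_supports (C i) d p (q i)" if i: "i \<in> N" for i
    unfolding price_supports_def
  proof
    fix y assume y: "y \<in> {0..d}"
    have le: "p \<le> D i (q i)"
      unfolding p_def using marginal_cost_le_of_social_optimum[OF \<open>finite N\<close> opt m(1) i m(2)] D m i by blast
    have "p * (y - q i) \<le> D i (q i) * (y - q i)"
    proof (cases "q i > 0")
      case True
      then have "D i (q i) \<le> p"
        unfolding p_def using marginal_cost_le_of_social_optimum[OF \<open>finite N\<close> opt i m(1)] D m i by blast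
      with le show ?thesis by simp
    next
      case False
      then have "q i = 0"
        using opt i by (force simp: social_optimum_def is_arg_min_def feasible_dispatch_def)
      with le y show ?thesis by (simp add: mult_right_mono)
    qed
    also have "\<dots> \<le> C i y - C i (q i)"
      by (rule tangent[OF i])
    finally show "p * (y - q i) \<le> C i y - C i (q i)" .
  qed
  ultimately show ?thesis
    by (rule that)
qed

section \<open>Nash equilibria\<close>

lemma social_optimum_imp_nash_equilibrium:
  assumes "finite N" "d > 0" and cost: "\<And>i. i \<in> N \<Longrightarrow> cost_function (C i)"
    and opt: "social_optimum N C d q" and two: "card {i \<in> N. q i > 0} \<ge> 2"
  shows "\<exists>p>0. nash_equilibrium N C d \<phi> K (\<lambda>i. q i / p) p"
proof -
  have nonneg: "\<And>i. i \<in> N \<Longrightarrow> 0 \<le> q i" and total: "sum q N = d"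
    using opt by (auto simp: social_optimum_def is_arg_min_def feasible_dispatch_def)
  have "{i \<in> N. q i > 0} \<noteq> {}"
    using two by (metis card.empty not_numeral_le_zero)
  then obtain m where m: "m \<in> N" "q m > 0"
    by blast
  obtain p where p: "p > 0" "\<And>i. i \<in> N \<Longrightarrow> price_supports (C i) d p (q i)"
    using social_optimum_imp_price_supports[OF \<open>finite N\<close> cost opt m] by blast
  define B where "B i = q i / p" for i
  have "sum B N = d / p"
    by (simp add: B_def total flip: sum_divide_distrib)
  have "optimal_bid N C d \<phi> K B i (B i)" if i: "i \<in> N" for i
  proof -
    \<comment> \<open>Of two active firms, one differs from \<open>i\<close>, whether or not \<open>i\<close> is active itself.\<close>
    have "\<not> {k \<in> N. q k > 0} \<subseteq> {i}"
      using two card_mono[of "{i}" "{k \<in> N. q k > 0}"] by auto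
    then obtain k where k: "k \<in> N - {i}" "q k > 0"
      by blast
    have "others_bid N B i > 0"
      unfolding others_bid_def using k p(1) nonneg \<open>finite N\<close>
      by (intro sum_pos2[of _ k]) (auto simp: B_def)
    moreover have "B i + others_bid N B i = d / p"
      using sum_eq_bid_plus_others[OF \<open>finite N\<close> i, of B] \<open>sum B N = d / p\<close> by simp
    moreover have "B i * d / (d / p) = q i"
      using p(1) \<open>d > 0\<close> by (simp add: B_def)
    ultimately show ?thesis
      using optimal_bid_iff_price_supports[OF \<open>finite N\<close> i \<open>d > 0\<close>, of C B "B i"]
        cost[OF i] p(1) p(2)[OF i] nonneg[OF i] \<open>d > 0\<close>
      by (simp add: cost_function_def B_def)
  qed
  moreover have "(\<Sum>i\<in>N. B i * p) = d"
    using p(1) total by (simp add: B_def)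
  ultimately have "nash_equilibrium N C d \<phi> K B p"
    by (simp add: nash_equilibrium_def)
  with p(1) show ?thesis
    unfolding B_def by blast
qed

lemma nash_equilibrium_imp_social_optimum:
  assumes "finite N" "d > 0" and cvx: "\<And>i. i \<in> N \<Longrightarrow> convex_on UNIV (C i)"
    and ne: "nash_equilibrium N C d \<phi> K B p"
  shows "social_optimum N C d (\<lambda>i. B i * p)"
proof -
  have opt: "optimal_bid N C d \<phi> K B i (B i)" if "i \<in> N" for i
    using ne that by (simp add: nash_equilibrium_def)
  then have nonneg: "0 \<le> B i" if "i \<in> N" for i
    using that by (auto simp: optimal_bid_def is_arg_max_def admissible_bid_def)
  have clear: "sum B N * p = d"
    using ne by (simp add: nash_equilibrium_def flip: sum_distrib_right)
  have "sum B N \<ge> 0"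
    using nonneg by (simp add: sum_nonneg)
  with clear \<open>d > 0\<close> have p: "p = d / sum B N" "p > 0"
    by (auto simp: field_simps zero_less_mult_iff)
  show ?thesis
  proof (rule price_supports_imp_social_optimum[OF \<open>finite N\<close>])
    show "feasible_dispatch N d (\<lambda>i. B i * p)"
      using nonneg p(2) ne by (auto simp: feasible_dispatch_def nash_equilibrium_def)
    show "price_supports (C i) d p (B i * p)" if i: "i \<in> N" for i
    proof -
      have "others_bid N B i \<noteq> 0"
        using no_optimal_bid_alone[OF \<open>finite N\<close> i \<open>d > 0\<close>] opt[OF i] by blast
      moreover have "others_bid N B i \<ge> 0"
        unfolding others_bid_def using nonneg by (intro sum_nonneg) auto
      ultimately have "price_supports (C i) d (d / sum B N) (B i * d / sum B N)"
        using optimal_bid_iff_price_supports[of N i d C B "B i"] \<open>finite N\<close> i \<open>d > 0\<close> cvx[OF i]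
          opt[OF i] nonneg[OF i] sum_eq_bid_plus_others[OF \<open>finite N\<close> i, of B] by simp
      then show ?thesis
        by (simp add: p(1))
    qed
  qed
qed

theorem theorem3p2:
  fixes N :: "'i set"
    and C :: "'i \<Rightarrow> real \<Rightarrow> real"
    and d \<phi> :: real
    and K qstar :: "'i \<Rightarrow> real"
  assumes "finite N"
    and "d > 0"
    and "\<And>i. i \<in> N \<Longrightarrow> cost_function (C i)"
    and "social_optimum N C d qstar"
    and "card {i \<in> N. qstar i > 0} \<ge> 2"
  shows "(\<exists>B p. nash_equilibrium N C d \<phi> K B p) \<and>
         (\<forall>B p. nash_equilibrium N C d \<phi> K B p \<longrightarrow> social_optimum N C d (\<lambda>i. B i * p))"
  using social_optimum_imp_nash_equilibrium[OF assms]
    nash_equilibrium_imp_social_optimum[OF assms(1,2)] assms(3)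
  unfolding cost_function_def by blast

end
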